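(* Let $s,k,n$ be integers and $m\ge 1$. Let $p,q,r,a,b,c$ be real numbers with $c\neq 0$, let $(P_n)_{n\in\mathbb{Z}}=\mathcal{P}(x)(p,q,r;a,b,c)$, $(U_n)_{n\in\mathbb{Z}}=\mathcal{P}(x)(0,0,1;a,b,c)$, and $\Delta_{\mathcal{P}}=(q^2-apq)x^2+(2qr-apr-bpq)x+(r^2-bpr-cp^2)$. Then \[ \det\big([P_{s+k(n+i+j)}^m]_{0\le i,j\le m}\big) = (-1)^{(s+kn+1)\binom{m+1}{2}}\,\Delta_{\mathcal{P}}^{\binom{m+1}{2}}\, c^{(s+kn)\binom{m+1}{2}+2k\binom{m+1}{3}}\prod_{i=0}^m\Big(\binom{m}{i}U_{k(i+1)}^{2(m-i)}\Big). \]
   Context: For real numbers $p,q,r,a,b,c$ with $c\neq 0$, $\mathcal{P}(x)(p,q,r;a,b,c)=(P_n)_{n\in\mathbb{Z}}$ denotes the sequence of polynomials in $x$ defined by $P_0=p$, $P_1=qx+r$, $P_{n+2}=(ax+b)P_{n+1}+cP_n$ for $n\ge 0$, and for $n<0$ by $P_n=-\frac{ax+b}{c}P_{n+1}+\frac{1}{c}P_{n+2}$; so $U_0=0$, $U_1=1$. $[M_{i,j}]_{0\le i,j\le m}$ is the $(m+1)\times(m+1)$ matrix with entry $M_{i,j}$ in row $i$, column $j$; $P^m_{t}$ means $(P_t)^m$. *)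

theory Defs
  imports "HOL-Computational_Algebra.Polynomial" "Jordan_Normal_Form.Determinant"
begin

text \<open>
  The two-sided sequence of real polynomials in \<open>x\<close>, with \<open>[:r, q:]\<close> standing for \<open>q x + r\<close> and
  \<open>[:b, a:]\<close> for \<open>a x + b\<close>. It is meaningful only for \<open>c \<noteq> 0\<close>.
\<close>

function poly_seq :: "real \<Rightarrow> real \<Rightarrow> real \<Rightarrow> real \<Rightarrow> real \<Rightarrow> real \<Rightarrow> int \<Rightarrow> real poly" where
  "poly_seq p q r a b c n =
     (if n = 0 then [:p:]
      else if n = 1 then [:r, q:]
      else if n \<ge> 2 then
        [:b, a:] * poly_seq p q r a b c (n - 1) + smult c (poly_seq p q r a b c (n - 2))
      else
        - smult (1 / c) ([:b, a:] * poly_seq p q r a b c (n + 1))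
          + smult (1 / c) (poly_seq p q r a b c (n + 2)))"
  by pat_completeness auto
termination
  by (relation "measure (\<lambda>(p, q, r, a, b, c, n). if n \<ge> 0 then nat n else nat (1 - n))") auto

declare poly_seq.simps [simp del]

lemma poly_seq_0: "poly_seq p q r a b c 0 = [:p:]"
  by (simp add: poly_seq.simps)

lemma poly_seq_1: "poly_seq p q r a b c 1 = [:r, q:]"
  by (simp add: poly_seq.simps)

lemma poly_seq_forward:
  assumes "n \<ge> 0"
  shows "poly_seq p q r a b c (n + 2) =
           [:b, a:] * poly_seq p q r a b c (n + 1) + smult c (poly_seq p q r a b c n)"
  using assms by (subst poly_seq.simps) (simp add: algebra_simps)

lemma poly_seq_backward:
  assumes "n < 0"
  shows "poly_seq p q r a b c n =
           - smult (1 / c) ([:b, a:] * poly_seq p q r a b c (n + 1))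
             + smult (1 / c) (poly_seq p q r a b c (n + 2))"
  using assms by (subst poly_seq.simps) simp

definition Delta_poly :: "real \<Rightarrow> real \<Rightarrow> real \<Rightarrow> real \<Rightarrow> real \<Rightarrow> real \<Rightarrow> real poly" where
  "Delta_poly p q r a b c =
     [: r\<^sup>2 - b * p * r - c * p\<^sup>2, 2 * q * r - a * p * r - b * p * q, q\<^sup>2 - a * p * q :]"

end

theory Submission imports Defs begin

text \<open>
  The addition formula \<open>P (u + v) = U v P (u + 1) + c U (v - 1) P u\<close> and the binomial theorem
  factor the matrix, with \<open>t = s + k n\<close>, as \<open>A D B\<^sup>T\<close>, where \<open>D\<close> is diagonal with entries
  \<open>binom(m, l) c ^ (m - l)\<close> and \<open>A\<close>, \<open>B\<close> are the homogeneous Vandermonde matrices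
  \<open>(x\<^sub>i ^ l y\<^sub>i ^ (m - l))\<close> of the pairs \<open>(P (t + k i + 1), P (t + k i))\<close> and
  \<open>(U (k i), U (k i - 1))\<close>. Their determinants are products of the minors \<open>x\<^sub>j y\<^sub>i - x\<^sub>i y\<^sub>j\<close>,
  which a generalised Cassini identity evaluates to \<open>- (- c) ^ u U (k (j - i)) \<Delta>\<close> with
  \<open>u = t + k i\<close> for \<open>A\<close>, and with \<open>u = k i - 1\<close>, \<open>\<Delta> = 1\<close> for \<open>B\<close>. This route avoids the roots of
  the characteristic polynomial, which may coincide.
\<close>

section \<open>The homogeneous Vandermonde determinant\<close>

lemma det_mat_diag:
  "det (mat_diag n (f :: nat \<Rightarrow> 'a :: comm_ring_1)) = (\<Prod>i<n. f i)"
proof -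
  have "det (mat_diag n f) = prod_list (diag_mat (mat_diag n f))"
    by (rule det_upper_triangular[OF _ mat_diag_dim]) (auto simp: mat_diag_def)
  then show ?thesis
    by (simp add: prod_list_diag_prod mat_diag_def atLeast0LessThan)
qed

lemma det_mult_rows:
  fixes f :: "nat \<Rightarrow> 'a :: comm_ring_1"
  shows "det (mat n n (\<lambda>(i, j). f i * g i j)) = (\<Prod>i<n. f i) * det (mat n n (\<lambda>(i, j). g i j))"
proof -
  have "mat n n (\<lambda>(i, j). f i * g i j) = mat_diag n f * mat n n (\<lambda>(i, j). g i j)"
    by (subst mat_diag_mult_left[of _ n n]) auto
  then show ?thesis
    by (simp add: det_mult[of _ n] det_mat_diag)
qed

text \<open>Only one term of the expansion along row 0 survives. The two uses are
  \<open>l = Suc m\<close> when \<open>y 0 = 0\<close>, and \<open>l = 0\<close> after column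
  operations otherwise.\<close>

lemma det_single_entry_row0:
  fixes M :: "nat \<Rightarrow> nat \<Rightarrow> 'a :: comm_ring_1"
  assumes "l \<le> n" and "\<And>j. j \<le> n \<Longrightarrow> j \<noteq> l \<Longrightarrow> M 0 j = 0"
  shows "det (mat (Suc n) (Suc n) (\<lambda>(i, j). M i j)) =
    (-1) ^ l * M 0 l * det (mat n n (\<lambda>(i, j). M (Suc i) (if j < l then j else Suc j)))"
proof -
  let ?A = "mat (Suc n) (Suc n) (\<lambda>(i, j). M i j)"
  have "det ?A = (\<Sum>j<Suc n. ?A $$ (0, j) * cofactor ?A 0 j)"
    by (rule laplace_expansion_row) auto
  also have "\<dots> = (\<Sum>j<Suc n. if j = l then M 0 l * cofactor ?A 0 l else 0)"
    using assms by (intro sum.cong) auto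
  also have "\<dots> = M 0 l * cofactor ?A 0 l"
    using assms by simp
  also have "mat_delete ?A 0 l = mat n n (\<lambda>(i, j). M (Suc i) (if j < l then j else Suc j))"
    using assms by (intro eq_matI) (auto simp: mat_delete_def)
  then have "M 0 l * cofactor ?A 0 l =
      (-1) ^ l * M 0 l * det (mat n n (\<lambda>(i, j). M (Suc i) (if j < l then j else Suc j)))"
    by (simp add: cofactor_def ac_simps)
  finally show ?thesis .
qed

text \<open>The homogeneous form avoids the quotients \<open>x i / y i\<close>, since
  \<open>y i\<close> may vanish: \<open>U (k i - 1)\<close> is \<open>U 0 = 0\<close> for
  \<open>k = i = 1\<close>.\<close>

definition hom_vandermonde :: "nat \<Rightarrow> (nat \<Rightarrow> 'a) \<Rightarrow> (nat \<Rightarrow> 'a) \<Rightarrow> 'a :: comm_ring_1 mat" where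
  "hom_vandermonde m x y = mat (Suc m) (Suc m) (\<lambda>(i, j). x i ^ j * y i ^ (m - j))"

lemma hom_vandermonde_carrier [simp]: "hom_vandermonde m x y \<in> carrier_mat (Suc m) (Suc m)"
  by (simp add: hom_vandermonde_def)

text \<open>Splits off the minors that involve row 0, as in the classical induction for Vandermonde
  determinants.\<close>

lemma det_hom_vandermonde_Suc:
  fixes x y :: "nat \<Rightarrow> 'a :: idom"
  shows "det (hom_vandermonde (Suc m) x y) =
    (\<Prod>i<Suc m. x (Suc i) * y 0 - x 0 * y (Suc i)) *
      det (hom_vandermonde m (\<lambda>i. x (Suc i)) (\<lambda>i. y (Suc i)))"
proof (cases "y 0 = 0")
  case True
  have "det (hom_vandermonde (Suc m) x y) = (-1) ^ Suc m * x 0 ^ Suc m *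
      det (mat (Suc m) (Suc m) (\<lambda>(i, j). x (Suc i) ^ j * y (Suc i) ^ (Suc m - j)))"
    unfolding hom_vandermonde_def
    by (subst det_single_entry_row0[where l = "Suc m"])
      (auto simp: True intro!: arg_cong[where f = det] cong_mat)
  \<comment> \<open>With the last column deleted, every exponent of \<open>y (Suc i)\<close> is
    positive, so each row yields one factor \<open>y (Suc i)\<close>. Together with the factors
    \<open>- x 0\<close> these are the minors for \<open>y 0 = 0\<close>.\<close>
  also have "mat (Suc m) (Suc m) (\<lambda>(i, j). x (Suc i) ^ j * y (Suc i) ^ (Suc m - j)) =
      mat (Suc m) (Suc m) (\<lambda>(i, j). y (Suc i) * (x (Suc i) ^ j * y (Suc i) ^ (m - j)))"
    by (auto intro!: cong_mat simp: Suc_diff_le)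
  also have "(-1) ^ Suc m * x 0 ^ Suc m * det \<dots> = (- x 0) ^ Suc m * (\<Prod>i<Suc m. y (Suc i)) *
      det (hom_vandermonde m (\<lambda>i. x (Suc i)) (\<lambda>i. y (Suc i)))"
    unfolding det_mult_rows hom_vandermonde_def power_minus[of "x 0"] by (simp only: ac_simps)
  also have "(- x 0) ^ Suc m * (\<Prod>i<Suc m. y (Suc i)) = (\<Prod>i<Suc m. - x 0 * y (Suc i))"
    unfolding prod.distrib by simp
  finally show ?thesis
    by (simp add: True)
next
  case False
  let ?V = "hom_vandermonde (Suc m) x y"
  \<comment> \<open>Right multiplication by \<open>E\<close> replaces column \<open>j\<close> by \<open>y 0\<close> times it minus \<open>x 0\<close> times
    column \<open>j - 1\<close>, which clears row \<open>0\<close>; it costs a factor \<open>y 0 ^ Suc m\<close>, cancelled at the end,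
    whence the case distinction.\<close>
  define E where "E = mat (Suc (Suc m)) (Suc (Suc m)) (\<lambda>(l, j).
    if l = j then (if j = 0 then 1 else y 0) else if Suc l = j then - x 0 else 0)"
  \<comment> \<open>For \<open>j > 0\<close> the two monomials combined by \<open>E\<close> differ
    by one exchange of \<open>x i\<close> for \<open>y i\<close>; their common factor leaves the
    minor of rows \<open>i\<close> and 0, which is zero for \<open>i = 0\<close>.\<close>
  define W where "W = (\<lambda>i j. if j = 0 then y i ^ Suc m
    else (x i * y 0 - x 0 * y i) * (x i ^ (j - 1) * y i ^ (Suc m - j)))"
  have E: "E \<in> carrier_mat (Suc (Suc m)) (Suc (Suc m))"
    by (simp add: E_def)
  have "det E = prod_list (diag_mat E)"
    by (rule det_upper_triangular[OF _ E]) (auto simp: E_def)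
  also have "\<dots> = (\<Prod>i<Suc (Suc m). if i = 0 then 1 else y 0)"
    by (auto simp: prod_list_diag_prod E_def atLeast0LessThan intro!: prod.cong)
  also have "\<dots> = y 0 ^ Suc m"
    by (subst prod.lessThan_Suc_shift) simp
  finally have det_E: "det E = y 0 ^ Suc m" .
  have VE: "?V * E = mat (Suc (Suc m)) (Suc (Suc m)) (\<lambda>(i, j). W i j)"
  proof (rule eq_matI)
    fix i j
    assume "i < dim_row (mat (Suc (Suc m)) (Suc (Suc m)) (\<lambda>(i, j). W i j))"
      and "j < dim_col (mat (Suc (Suc m)) (Suc (Suc m)) (\<lambda>(i, j). W i j))"
    then have i: "i < Suc (Suc m)" and j: "j < Suc (Suc m)"
      by auto
    let ?v = "\<lambda>l. x i ^ l * y i ^ (Suc m - l)"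
    have "(?V * E) $$ (i, j) = (\<Sum>l<Suc (Suc m). ?v l *
        (if l = j then (if j = 0 then 1 else y 0) else if Suc l = j then - x 0 else 0))"
      using i j by (auto simp: hom_vandermonde_def E_def scalar_prod_def atLeast0LessThan
          intro!: sum.cong)
    also have "\<dots> = W i j"
    proof (cases j)
      case 0
      then have "(\<Sum>l<Suc (Suc m). ?v l *
          (if l = j then (if j = 0 then 1 else y 0) else if Suc l = j then - x 0 else 0)) =
        (\<Sum>l<Suc (Suc m). if l = 0 then ?v 0 else 0)"
        by (intro sum.cong) auto
      then show ?thesis
        using 0 by (simp add: W_def)
    next
      case (Suc d)
      then have d: "d \<le> m"
        using j by simp
      have "(\<Sum>l<Suc (Suc m). ?v l *
          (if l = j then (if j = 0 then 1 else y 0) else if Suc l = j then - x 0 else 0)) =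
        (\<Sum>l<Suc (Suc m). (if l = Suc d then ?v (Suc d) * y 0 else 0) +
          (if l = d then - (?v d * x 0) else 0))"
        using Suc by (intro sum.cong) auto
      also have "\<dots> = ?v (Suc d) * y 0 - ?v d * x 0"
        using d by (simp only: sum.distrib sum.delta finite_lessThan lessThan_iff) simp
      also have "\<dots> = W i j"
        using d Suc by (simp add: W_def Suc_diff_le algebra_simps)
      finally show ?thesis .
    qed
    finally show "(?V * E) $$ (i, j) = mat (Suc (Suc m)) (Suc (Suc m)) (\<lambda>(i, j). W i j) $$ (i, j)"
      using i j by simp
  qed (auto simp: hom_vandermonde_def E_def)
  have "det ?V * y 0 ^ Suc m = det (?V * E)"
    using det_mult[OF hom_vandermonde_carrier E] det_E by simp
  also have "\<dots> = W 0 0 * det (mat (Suc m) (Suc m) (\<lambda>(i, j). W (Suc i) (Suc j)))"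
    unfolding VE by (subst det_single_entry_row0[where l = 0]) (auto simp: W_def)
  also have "mat (Suc m) (Suc m) (\<lambda>(i, j). W (Suc i) (Suc j)) =
      mat (Suc m) (Suc m) (\<lambda>(i, j). (x (Suc i) * y 0 - x 0 * y (Suc i)) *
        (x (Suc i) ^ j * y (Suc i) ^ (m - j)))"
    by (auto simp: W_def intro!: cong_mat)
  also have "W 0 0 * det \<dots> = ((\<Prod>i<Suc m. x (Suc i) * y 0 - x 0 * y (Suc i)) *
      det (hom_vandermonde m (\<lambda>i. x (Suc i)) (\<lambda>i. y (Suc i)))) * y 0 ^ Suc m"
    unfolding det_mult_rows hom_vandermonde_def by (simp add: W_def)
  finally show ?thesis
    using False by (simp del: prod.lessThan_Suc power_Suc)
qed

lemma det_hom_vandermonde: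
  fixes x y :: "nat \<Rightarrow> 'a :: idom"
  shows "det (hom_vandermonde m x y) = (\<Prod>j\<le>m. \<Prod>i<j. x j * y i - x i * y j)"
proof (induction m arbitrary: x y)
  case 0
  show ?case
    by (simp add: det_single hom_vandermonde_def)
next
  case (Suc m)
  show ?case
    \<comment> \<open>Splitting \<open>i = 0\<close> off every inner product leaves the pairs with
      both indices shifted by one, as in the induction hypothesis.\<close>
    unfolding det_hom_vandermonde_Suc Suc.IH lessThan_Suc_atMost[of m]
      prod.atMost_Suc_shift[of _ m] prod.lessThan_Suc_shift prod.distrib
    by simp
qed

section \<open>Products over pairs of indices\<close>

text \<open>Among the pairs \<open>i < j\<close> in \<open>0..m\<close>, the difference
  \<open>d + 1\<close> occurs \<open>m - d\<close> times.\<close>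

lemma prod_pairs_diff:
  fixes g :: "nat \<Rightarrow> 'a :: comm_monoid_mult"
  shows "(\<Prod>j\<le>m. \<Prod>i<j. g (j - i)) = (\<Prod>i\<le>m. g (Suc i) ^ (m - i))"
proof (induction m)
  case (Suc m)
  \<comment> \<open>The new index \<open>j = Suc m\<close> contributes each difference from 1 to
    \<open>Suc m\<close> once and so raises every exponent by one.\<close>
  have "(\<Prod>i<Suc m. g (Suc m - i)) = (\<Prod>i<Suc m. g (Suc i))"
    using prod.nat_diff_reindex[of "\<lambda>i. g (Suc i)" "Suc m"]
    by (simp add: Suc_diff_le del: prod.lessThan_Suc cong: prod.cong_simp)
  moreover have "(\<Prod>i\<le>m. g (Suc i) ^ (Suc m - i)) = (\<Prod>i\<le>m. g (Suc i) ^ (m - i) * g (Suc i))"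
    by (intro prod.cong) (auto simp: Suc_diff_le ac_simps)
  ultimately show ?case
    using Suc by (simp add: prod.distrib lessThan_Suc_atMost del: prod.lessThan_Suc)
qed simp

lemma prod_pairs_const:
  "(\<Prod>j\<le>m. \<Prod>i<j. (d :: 'a :: comm_monoid_mult)) = d ^ (Suc m choose 2)"
proof (induction m)
  case (Suc m)
  have "Suc (Suc m) choose 2 = Suc m + (Suc m choose 2)"
    by (simp add: numeral_2_eq_2)
  with Suc show ?case
    by (simp add: power_add ac_simps)
qed (simp add: numeral_2_eq_2)

text \<open>The smaller indices below \<open>j\<close> sum to \<open>j choose 2\<close>, and summing
  this over \<open>j\<close> gives \<open>Suc m choose 3\<close> by the hockey-stick identity. This
  is the source of the cubic binomial in the theorem.\<close>

lemma prod_pairs_powi: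
  fixes z :: "'a :: field"
  assumes "z \<noteq> 0"
  shows "(\<Prod>j\<le>m. \<Prod>i<j. z powi (e + d * int i)) =
    z powi (e * int (Suc m choose 2) + d * int (Suc m choose 3))"
proof (induction m)
  case 0
  show ?case
    by (simp add: numeral_eq_Suc)
next
  case (Suc m)
  have row: "(\<Prod>i<l. z powi (e + d * int i)) = z powi (e * int l + d * int (l choose 2))" for l
  proof (induction l)
    case (Suc l)
    have "Suc l choose 2 = l + (l choose 2)"
      by (simp add: numeral_2_eq_2)
    with Suc show ?case
      using assms by (simp add: power_int_add[symmetric] algebra_simps)
  qed (simp add: numeral_2_eq_2)
  have "Suc (Suc m) choose 2 = Suc m + (Suc m choose 2)"
    "Suc (Suc m) choose 3 = (Suc m choose 2) + (Suc m choose 3)"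
    by (simp_all add: numeral_eq_Suc)
  then show ?case
    using assms unfolding prod.atMost_Suc Suc.IH
    by (simp only: row) (simp add: power_int_add[symmetric] algebra_simps)
qed

section \<open>The two-sided recurrence\<close>

text \<open>At negative indices the definition is the recurrence solved for its last term;
  multiplying by \<open>c\<close> recovers the recurrence there.\<close>

lemma poly_seq_rec:
  assumes "c \<noteq> 0"
  shows "poly_seq p q r a b c (n + 2) =
    [:b, a:] * poly_seq p q r a b c (n + 1) + smult c (poly_seq p q r a b c n)"
proof (cases "n \<ge> 0")
  case True
  then show ?thesis
    by (rule poly_seq_forward)
next
  case False
  then have "smult c (poly_seq p q r a b c n) =
      - ([:b, a:] * poly_seq p q r a b c (n + 1)) + poly_seq p q r a b c (n + 2)"
    using assms by (subst poly_seq_backward) (simp_all only: smult_add_right smult_minus_right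
        smult_smult, simp_all)
  then show ?thesis
    by simp
qed

text \<open>A uniqueness principle: two adjacent values determine the sequence in both directions,
  where going down cancels \<open>c\<close>.\<close>

lemma two_sided_rec_eq_0:
  fixes f :: "int \<Rightarrow> 'a :: idom poly"
  assumes rec: "\<And>n. f (n + 2) = g * f (n + 1) + smult c (f n)"
    and "c \<noteq> 0" and "f 0 = 0" and "f 1 = 0"
  shows "f n = 0"
proof -
  have "f n = 0 \<and> f (n + 1) = 0"
  proof (induction n rule: int_induct[where k = 0])
    case (step1 n)
    then show ?case
      using rec[of n] by (simp add: add.commute)
  next
    case (step2 n)
    then show ?case
      using rec[of "n - 1"] assms(2) by (simp add: add.commute)
  qed (use assms in simp)
  then show ?thesis ..
qed

lemma poly_seq_fundamental_minus_1:
  assumes "c \<noteq> 0"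
  shows "smult c (poly_seq 0 0 1 a b c (- 1)) = 1"
  using poly_seq_rec[OF assms, of 0 0 1 a b "- 1"]
  by (simp add: poly_seq_0 poly_seq_1 one_pCons)

text \<open>In \<open>v\<close>, both sides satisfy the same recurrence and agree at 0 and
  1.\<close>

lemma poly_seq_add:
  assumes c: "c \<noteq> 0"
  shows "poly_seq p q r a b c (u + v) =
    poly_seq 0 0 1 a b c v * poly_seq p q r a b c (u + 1) +
    smult c (poly_seq 0 0 1 a b c (v - 1) * poly_seq p q r a b c u)"
proof -
  let ?P = "poly_seq p q r a b c" and ?U = "poly_seq 0 0 1 a b c"
  define f where "f = (\<lambda>v. ?P (u + v) - ?U v * ?P (u + 1) - smult c (?U (v - 1) * ?P u))"
  have "f v = 0"
  proof (rule two_sided_rec_eq_0[OF _ c])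
    fix v
    have "?P (u + (v + 2)) = [:b, a:] * ?P (u + (v + 1)) + smult c (?P (u + v))"
      "?U (v + 2) = [:b, a:] * ?U (v + 1) + smult c (?U v)"
      "?U (v + 2 - 1) = [:b, a:] * ?U (v + 1 - 1) + smult c (?U (v - 1))"
      using poly_seq_rec[OF c, of p q r a b "u + v"] poly_seq_rec[OF c, of 0 0 1 a b v]
        poly_seq_rec[OF c, of 0 0 1 a b "v - 1"] by (simp_all add: add.assoc)
    then show "f (v + 2) = [:b, a:] * f (v + 1) + smult c (f v)"
      unfolding f_def by (simp only:) (simp add: algebra_simps smult_add_right smult_diff_right
          del: mult_pCons_left mult_pCons_right)
  next
    \<comment> \<open>At \<open>v = 0\<close> the formula rests on
      \<open>c U (-1) = 1\<close>.\<close>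
    have "smult c (?U (- 1) * ?P u) = smult c (?U (- 1)) * ?P u"
      by simp
    then show "f 0 = 0"
      unfolding f_def by (simp only: poly_seq_fundamental_minus_1[OF c] diff_0) (simp add: poly_seq_0)
  qed (simp add: f_def poly_seq_0 poly_seq_1)
  then show ?thesis
    by (simp add: f_def algebra_simps)
qed

text \<open>By the recurrence, the left side is multiplied by \<open>- c\<close> whenever
  \<open>u\<close> grows by one; at \<open>u = 0\<close> it is minus the discriminant-like
  polynomial \<open>Delta_poly\<close>.\<close>

lemma poly_seq_cassini:
  assumes c: "c \<noteq> 0"
  shows "poly_seq p q r a b c (u + 2) * poly_seq p q r a b c u - (poly_seq p q r a b c (u + 1))\<^sup>2 =
    - smult ((- c) powi u) (Delta_poly p q r a b c)"
proof -
  let ?P = "poly_seq p q r a b c"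
  define f where "f = (\<lambda>u. ?P (u + 2) * ?P u - (?P (u + 1))\<^sup>2)"
  have step: "f (u + 1) = smult (- c) (f u)" for u
  proof -
    have "?P (u + 2) = [:b, a:] * ?P (u + 1) + smult c (?P u)"
      "?P (u + 1 + 2) = [:b, a:] * ?P (u + 2) + smult c (?P (u + 1))" "u + 1 + 1 = u + 2"
      using poly_seq_rec[OF c, of p q r a b u] poly_seq_rec[OF c, of p q r a b "u + 1"]
      by (simp_all add: add.assoc)
    then show ?thesis
      unfolding f_def by (simp only:) (simp add: algebra_simps power2_eq_square smult_add_right
          smult_diff_right del: mult_pCons_left mult_pCons_right)
  qed
  have "f u = - smult ((- c) powi u) (Delta_poly p q r a b c)"
  proof (induction u rule: int_induct[where k = 0])
    case base
    show ?case
      using poly_seq_forward[of 0 p q r a b c]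
      by (simp add: f_def poly_seq_0 poly_seq_1 Delta_poly_def power2_eq_square algebra_simps)
  next
    case (step1 u)
    then show ?case
      using c by (simp add: step power_int_add mult.commute)
  next
    case (step2 u)
    have "(- c) powi u = (- c) * (- c) powi (u - 1)"
      using c power_int_add[of "- c" 1 "u - 1"] by simp
    moreover have "smult (- c) (f (u - 1)) = f u"
      using step[of "u - 1"] by simp
    ultimately have "smult (- c) (f (u - 1)) =
        smult (- c) (- smult ((- c) powi (u - 1)) (Delta_poly p q r a b c))"
      using step2 by (simp add: mult.assoc)
    \<comment> \<open>The downward step cancels the factor \<open>- c\<close>, which is
      invertible.\<close>
    then have "smult (inverse (- c)) (smult (- c) (f (u - 1))) = smult (inverse (- c))
        (smult (- c) (- smult ((- c) powi (u - 1)) (Delta_poly p q r a b c)))"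
      by (rule arg_cong)
    then show ?case
      using c by (simp only: smult_smult) simp
  qed
  then show ?thesis
    by (simp add: f_def)
qed

text \<open>Expanding \<open>P (u + d)\<close> and \<open>P (u + d + 1)\<close> by the addition
  formula, the terms with \<open>U (d - 1)\<close> cancel and \<open>U d\<close> times the case
  \<open>d = 1\<close> remains.\<close>

lemma poly_seq_cassini_gap:
  assumes c: "c \<noteq> 0"
  shows "poly_seq p q r a b c (u + d + 1) * poly_seq p q r a b c u -
      poly_seq p q r a b c (u + 1) * poly_seq p q r a b c (u + d) =
    - smult ((- c) powi u) (poly_seq 0 0 1 a b c d * Delta_poly p q r a b c)"
proof -
  let ?P = "poly_seq p q r a b c" and ?U = "poly_seq 0 0 1 a b c"
  have "?P (u + d) = ?U d * ?P (u + 1) + smult c (?U (d - 1) * ?P u)"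
    by (rule poly_seq_add[OF c])
  moreover have "?P (u + d + 1) = ?U d * ?P (u + 2) + smult c (?U (d - 1) * ?P (u + 1))"
    using poly_seq_add[OF c, of p q r a b "u + 1" d] by (simp add: ac_simps)
  ultimately have "?P (u + d + 1) * ?P u - ?P (u + 1) * ?P (u + d) =
      ?U d * (?P (u + 2) * ?P u - (?P (u + 1))\<^sup>2)"
    by (simp only:) (simp add: algebra_simps power2_eq_square)
  then show ?thesis
    by (simp add: poly_seq_cassini[OF c])
qed

section \<open>The determinant\<close>

lemma Delta_poly_fundamental: "Delta_poly 0 0 1 a b c = 1"
  by (simp add: Delta_poly_def one_pCons)

theorem theorem2:
  fixes s k n :: int and m :: nat and p q r a b c :: real
    and P U :: "int \<Rightarrow> real poly"
  assumes "m \<ge> 1" and "c \<noteq> 0"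
  defines "P \<equiv> poly_seq p q r a b c"
    and "U \<equiv> poly_seq 0 0 1 a b c"
  shows "det (mat (m + 1) (m + 1) (\<lambda>(i, j). P (s + k * (n + int i + int j)) ^ m)) =
     [:(-1) powi ((s + k * n + 1) * int ((m + 1) choose 2)):]
     * Delta_poly p q r a b c ^ ((m + 1) choose 2)
     * [:c powi ((s + k * n) * int ((m + 1) choose 2) + 2 * k * int ((m + 1) choose 3)):]
     * (\<Prod>i = 0..m. of_nat (m choose i) * U (k * (int i + 1)) ^ (2 * (m - i)))"
proof -
  define t where "t = s + k * n"
  define N where "N = (Suc m choose 2)"
  define D where "D = Delta_poly p q r a b c"
  define A where "A = hom_vandermonde m (\<lambda>i. P (t + k * int i + 1)) (\<lambda>i. P (t + k * int i))"
  define B where "B = hom_vandermonde m (\<lambda>i. U (k * int i)) (\<lambda>i. U (k * int i - 1))"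
  define w where "w = (\<lambda>l. of_nat (m choose l) * [:c:] ^ (m - l) :: real poly)"
  note c = \<open>c \<noteq> 0\<close>
  have "mat (m + 1) (m + 1) (\<lambda>(i, j). P (s + k * (n + int i + int j)) ^ m) =
      A * (mat_diag (Suc m) w * transpose_mat B)"
  proof (rule eq_matI)
    fix i j
    assume "i < dim_row (A * (mat_diag (Suc m) w * transpose_mat B))"
      and "j < dim_col (A * (mat_diag (Suc m) w * transpose_mat B))"
    then have i: "i < Suc m" and j: "j < Suc m"
      by (auto simp: A_def B_def hom_vandermonde_def)
    let ?x = "P (t + k * int i + 1)" and ?y = "P (t + k * int i)"
    \<comment> \<open>The addition formula at \<open>u = t + k i\<close>, \<open>v = k j\<close>
      separates row from column index, so each entry is a power of a two-term sum.\<close>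
    have "P (s + k * (n + int i + int j)) = ?x * U (k * int j) + [:c:] * (?y * U (k * int j - 1))"
      using poly_seq_add[OF c, of p q r a b "t + k * int i" "k * int j"]
      by (simp add: P_def U_def t_def algebra_simps)
    also have "\<dots> ^ m = (\<Sum>l\<le>m. of_nat (m choose l) * (?x * U (k * int j)) ^ l *
        ([:c:] * (?y * U (k * int j - 1))) ^ (m - l))"
      by (rule binomial_ring)
    also have "\<dots> = (\<Sum>l<Suc m. (?x ^ l * ?y ^ (m - l)) *
        (w l * (U (k * int j) ^ l * U (k * int j - 1) ^ (m - l))))"
      unfolding lessThan_Suc_atMost w_def power_mult_distrib by (intro sum.cong refl) (simp only: ac_simps)
    also have "\<dots> = (A * (mat_diag (Suc m) w * transpose_mat B)) $$ (i, j)"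
      using i j by (subst mat_diag_mult_left[of _ "Suc m" "Suc m"])
        (auto simp: A_def B_def hom_vandermonde_def scalar_prod_def atLeast0LessThan
          simp del: sum.lessThan_Suc intro!: sum.cong)
    finally show "mat (m + 1) (m + 1) (\<lambda>(i, j). P (s + k * (n + int i + int j)) ^ m) $$ (i, j) =
        (A * (mat_diag (Suc m) w * transpose_mat B)) $$ (i, j)"
      using i j by simp
  qed (auto simp: A_def B_def hom_vandermonde_def)
  moreover have AB: "A \<in> carrier_mat (Suc m) (Suc m)" "B \<in> carrier_mat (Suc m) (Suc m)"
    by (simp_all add: A_def B_def)
  ultimately have "det (mat (m + 1) (m + 1) (\<lambda>(i, j). P (s + k * (n + int i + int j)) ^ m)) =
      (\<Prod>l\<le>m. w l) * (det A * det B)"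
    using AB(2) mult_carrier_mat[OF mat_diag_dim, of "transpose_mat B" "Suc m" "Suc m" w]
      det_mult[OF AB(1), of "mat_diag (Suc m) w * transpose_mat B"]
      det_mult[OF mat_diag_dim, of "transpose_mat B" "Suc m" w]
    by (simp add: det_transpose[OF AB(2)] det_mat_diag lessThan_Suc_atMost ac_simps
        del: prod.lessThan_Suc)
  also have "(\<Prod>l\<le>m. w l) = [:c ^ N:] * (\<Prod>i\<le>m. of_nat (m choose i))"
    \<comment> \<open>For a constant factor, counting pairs by difference shows that the exponents
      \<open>m - l\<close> sum to \<open>N\<close>.\<close>
    using prod_pairs_diff[of "\<lambda>_. [:c:]" m]
    by (simp only: w_def prod.distrib prod_pairs_const N_def poly_const_pow mult.commute)
  also have "det A * det B = D ^ N * [:(- c) powi ((t - 1) * int N + 2 * k * int (Suc m choose 3)):] *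
      (\<Prod>i\<le>m. U (k * (int i + 1)) ^ (2 * (m - i)))"
  proof -
    \<comment> \<open>For each pair the minus signs of the two Cassini identities cancel, and the
      exponents \<open>t + k i\<close> and \<open>k i - 1\<close> of \<open>- c\<close> add up to
      \<open>t - 1 + 2 k i\<close>.\<close>
    have "det A * det B = (\<Prod>j\<le>m. \<Prod>i<j.
        (D * [:(- c) powi ((t - 1) + 2 * k * int i):]) * (U (k * int (j - i)))\<^sup>2)"
      unfolding A_def B_def det_hom_vandermonde prod.distrib[symmetric]
    proof (intro prod.cong refl)
      fix j i :: nat
      assume "i \<in> {..<j}"
      then have kj: "k * int j = k * int i + k * int (j - i)"
        by (simp add: algebra_simps of_nat_diff)
      have 1: "P (t + k * int j + 1) * P (t + k * int i) - P (t + k * int i + 1) * P (t + k * int j) =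
          - smult ((- c) powi (t + k * int i)) (U (k * int (j - i)) * D)"
        using poly_seq_cassini_gap[OF c, of p q r a b "t + k * int i" "k * int (j - i)"]
        by (simp only: P_def U_def D_def kj add.assoc)
      have "U (k * int j) * U (k * int i - 1) - U (k * int i) * U (k * int j - 1) =
          - smult ((- c) powi (k * int i - 1)) (U (k * int (j - i)))"
        using poly_seq_cassini_gap[OF c, of 0 0 1 a b "k * int i - 1" "k * int (j - i)"]
        by (simp add: U_def kj Delta_poly_fundamental algebra_simps)
      moreover have "(- c) powi ((t - 1) + 2 * k * int i) =
          (- c) powi (t + k * int i) * (- c) powi (k * int i - 1)"
        using c by (simp add: power_int_add[symmetric] algebra_simps)
      ultimately show "(P (t + k * int j + 1) * P (t + k * int i) -
            P (t + k * int i + 1) * P (t + k * int j)) *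
          (U (k * int j) * U (k * int i - 1) - U (k * int i) * U (k * int j - 1)) =
          (D * [:(- c) powi ((t - 1) + 2 * k * int i):]) * (U (k * int (j - i)))\<^sup>2"
        using 1 by (simp add: power2_eq_square ac_simps)
    qed
    also have "\<dots> = D ^ N * (\<Prod>j\<le>m. \<Prod>i<j. [:(- c) powi ((t - 1) + 2 * k * int i):]) *
        (\<Prod>i\<le>m. (U (k * int (Suc i)))\<^sup>2 ^ (m - i))"
      using prod_pairs_diff[of "\<lambda>d. (U (k * int d))\<^sup>2" m]
      by (simp only: prod.distrib prod_pairs_const N_def)
    also have "(\<Prod>j\<le>m. \<Prod>i<j. [:(- c) powi ((t - 1) + 2 * k * int i):]) =
        [:\<Prod>j\<le>m. \<Prod>i<j. (- c) powi ((t - 1) + 2 * k * int i):]"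
      by (simp only: prod_to_poly)
    also have "(\<Prod>j\<le>m. \<Prod>i<j. (- c) powi ((t - 1) + 2 * k * int i)) =
        (- c) powi ((t - 1) * int N + 2 * k * int (Suc m choose 3))"
      using c by (simp only: prod_pairs_powi N_def neg_equal_0_iff_equal not_False_eq_True)
    finally show ?thesis
      by (simp add: power_mult[symmetric] ac_simps)
  qed
  also have "[:c ^ N:] * (\<Prod>i\<le>m. of_nat (m choose i)) *
      (D ^ N * [:(- c) powi ((t - 1) * int N + 2 * k * int (Suc m choose 3)):] *
        (\<Prod>i\<le>m. U (k * (int i + 1)) ^ (2 * (m - i)))) =
    [:c ^ N * (- c) powi ((t - 1) * int N + 2 * k * int (Suc m choose 3)):] * D ^ N *
      (\<Prod>i\<le>m. of_nat (m choose i) * U (k * (int i + 1)) ^ (2 * (m - i)))"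
    by (simp add: prod.distrib ac_simps)
  \<comment> \<open>The factor \<open>c ^ N\<close> from the diagonal lifts \<open>(t - 1) N\<close>
    to \<open>t N\<close>. For the sign only parity counts: \<open>t - 1\<close> may become
    \<open>t + 1\<close>, and the term with \<open>2 k\<close> drops out.\<close>
  also have "c ^ N * (- c) powi ((t - 1) * int N + 2 * k * int (Suc m choose 3)) =
      (-1) powi ((t + 1) * int N) * c powi (t * int N + 2 * k * int (Suc m choose 3))"
  proof -
    have "(- c) powi e = (-1) powi e * c powi e" for e
      using power_int_mult_distrib[of "-1" c e] by simp
    moreover have "(-1 :: real) powi ((t - 1) * int N + 2 * k * int (Suc m choose 3)) =
        (-1) powi ((t + 1) * int N)"
      by (simp add: power_int_minus_left)
    moreover have "c ^ N * c powi ((t - 1) * int N + 2 * k * int (Suc m choose 3)) =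
        c powi (t * int N + 2 * k * int (Suc m choose 3))"
      using c by (simp add: power_int_add[symmetric] power_int_of_nat[symmetric] algebra_simps
          del: power_int_of_nat)
    ultimately show ?thesis
      by (simp add: ac_simps)
  qed
  finally show ?thesis
    by (simp add: t_def N_def D_def atMost_atLeast0 ac_simps)
qed

end
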